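(* Let $f\colon\mathbb{R}^d\to\mathbb{R}$ be a piecewise affine function given in the min-max form $f(x)=\min_{i\in I}f_i(x)$ for all $x \in \mathbb{R}^d$, where $f_i(x)=\max_{j\in J(i)}(a_{ij}+\langle v_{ij},x\rangle)$ with $a_{ij}\in\mathbb{R}$, $v_{ij}\in\mathbb{R}^d$, $I=\{1,\ldots,\ell\}$, $J(i)=\{1,\ldots,s(i)\}$, and let $f_i^*=\inf_{x\in\mathbb{R}^d}f_i(x)$. Suppose that $S(f)=\{x\in\mathbb{R}^d\mid f(x)\le 0\}$ is nonempty. Then the following statements hold true: 1. if $f_i^*\le 0$ for all $i\in I$, then $f$ has a global error bound; 2. if there exists $i\in I$ such that $f_i^*>0$, then $f$ has an error bound on the set $V=\{x\in\mathbb{R}^d\mid f(x)<\rho\}$ with $\rho=\min\{f_i^*\mid i\in I\colon f_i^*>0\}$.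
   Context: $\mathbb{R}^d$ is equipped with an inner product $\langle\cdot,\cdot\rangle$ and an arbitrary norm $\|\cdot\|$; $\operatorname{dist}(x,Q)=\inf_{y\in Q}\|x-y\|$. A set is polyhedral if it is the intersection of finitely many closed half-spaces. A function $f\colon\mathbb{R}^d\to\mathbb{R}$ is piecewise affine if there are finitely many polyhedral sets $Q_1,\ldots,Q_s$ with nonempty, pairwise disjoint interiors covering $\mathbb{R}^d$ and affine functions $F_1,\ldots,F_s$ such that $f=F_k$ on $Q_k$ for each $k$. Every piecewise affine function admits a min-max representation of the form used in the claim (a known theorem of Gorokhovik and Zorko), and conversely any such function is piecewise affine. Put $[f]_+(x)=\max\{f(x),0\}$. The function $f$ has an error bound on a set $V\subseteq\mathbb{R}^d$ if there exists $\tau>0$ such that $\tau\operatorname{dist}(x,S(f))\le[f]_+(x)$ for all $x\in V$; $f$ has a global error bound if this holds for $V=\mathbb{R}^d$. *)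

theory Defs
  imports "HOL-Analysis.Analysis"
begin

(* The type class euclidean_space plays the role of R^d with its inner product. The norm N
   below is a separate, arbitrary one and need not be induced by the inner product; by the
   equivalence of norms in finite dimension it gives the same interiors as the class topology. *)

definition is_norm :: "('a::real_vector \<Rightarrow> real) \<Rightarrow> bool" where
  "is_norm N \<longleftrightarrow>
     (\<forall>x. N x \<ge> 0) \<and>
     (\<forall>x. N x = 0 \<longleftrightarrow> x = 0) \<and>
     (\<forall>c x. N (c *\<^sub>R x) = \<bar>c\<bar> * N x) \<and>
     (\<forall>x y. N (x + y) \<le> N x + N y)"

(* Meaningful only for Q \<noteq> {}: the infimum of the empty set of reals is a junk value. *)
definition norm_dist :: "('a::real_vector \<Rightarrow> real) \<Rightarrow> 'a \<Rightarrow> 'a set \<Rightarrow> real" where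
  "norm_dist N x Q = (INF y\<in>Q. N (x - y))"

definition affine_function :: "('a::euclidean_space \<Rightarrow> real) \<Rightarrow> bool" where
  "affine_function F \<longleftrightarrow> (\<exists>a v. \<forall>x. F x = a + v \<bullet> x)"

definition piecewise_affine :: "('a::euclidean_space \<Rightarrow> real) \<Rightarrow> bool" where
  "piecewise_affine f \<longleftrightarrow>
     (\<exists>(n::nat) (Q :: nat \<Rightarrow> 'a set) (F :: nat \<Rightarrow> 'a \<Rightarrow> real).
        (\<forall>k\<in>{1..n}. polyhedron (Q k) \<and> interior (Q k) \<noteq> {}) \<and>
        (\<forall>j\<in>{1..n}. \<forall>k\<in>{1..n}. j \<noteq> k \<longrightarrow> interior (Q j) \<inter> interior (Q k) = {}) \<and>
        (\<Union>k\<in>{1..n}. Q k) = UNIV \<and>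
        (\<forall>k\<in>{1..n}. affine_function (F k) \<and> (\<forall>x\<in>Q k. f x = F k x)))"

definition sublevel :: "('a \<Rightarrow> real) \<Rightarrow> 'a set" where
  "sublevel f = {x. f x \<le> 0}"

definition pos_part :: "('a \<Rightarrow> real) \<Rightarrow> 'a \<Rightarrow> real" where
  "pos_part f x = max (f x) 0"

definition error_bound_on ::
    "('a::real_vector \<Rightarrow> real) \<Rightarrow> ('a \<Rightarrow> real) \<Rightarrow> 'a set \<Rightarrow> bool" where
  "error_bound_on N f V \<longleftrightarrow>
     (\<exists>\<tau>>0. \<forall>x\<in>V. \<tau> * norm_dist N x (sublevel f) \<le> pos_part f x)"

definition global_error_bound :: "('a::real_vector \<Rightarrow> real) \<Rightarrow> ('a \<Rightarrow> real) \<Rightarrow> bool" where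
  "global_error_bound N f \<longleftrightarrow> error_bound_on N f UNIV"

(* Extended-real valued, since the infimum may be - \<infinity>. *)
definition inf_value :: "('a \<Rightarrow> real) \<Rightarrow> ereal" where
  "inf_value g = (INF x. ereal (g x))"

end

theory Submission
  imports Defs
begin

text \<open>On the region in question a positive value \<open>f x\<close> equals \<open>fi i x\<close> for some
  \<open>i\<close> whose infimum is at most 0, and since the sublevel set of \<open>fi i\<close> is contained in
  that of \<open>f\<close>, it suffices to have a global error bound for each such \<open>fi i\<close>. This is
  Hoffman's bound for a linear system. If \<open>y\<close> is the projection of \<open>x\<close> onto the
  solution set, then \<open>x - y\<close> lies in the cone generated by the normals \<open>U\<close> of the
  constraints active at \<open>y\<close>. Near 0 this cone coincides with the polytope
  \<open>convex hull (insert 0 U)\<close>, on which the functional \<open>w \<mapsto> w \<bullet> (x - y)\<close> is at most the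
  residual of the system at \<open>x\<close>. The constant depends on the normals only; applied to
  the systems \<open>fi i \<le> \<epsilon>\<close> with \<open>\<epsilon> \<rightarrow> 0\<close>, the bound and compactness also show that
  the infimum 0 is attained.\<close>

section \<open>Finitely generated cones\<close>

text \<open>The polytope is an intersection of finitely many half-spaces containing 0. Those with 0
  on the boundary are closed under nonnegative scaling and so contain the whole cone; each of the
  others contains a ball around 0, and the smallest radius is positive by finiteness.\<close>

lemma convex_cone_hull_near_0:
  fixes V :: "'a::euclidean_space set"
  assumes "finite V"
  obtains r where "r > 0" "convex_cone hull V \<inter> cball 0 r \<subseteq> convex hull (insert 0 V)"
proof -
  define K where "K = convex hull (insert 0 V)"
  have "polyhedron K"
    unfolding K_def using assms by (intro polytope_imp_polyhedron) (auto simp: polytope_def)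
  then obtain F where F: "finite F" "K = \<Inter>F"
    and "\<forall>h\<in>F. \<exists>a b. a \<noteq> 0 \<and> h = {x. a \<bullet> x \<le> b}"
    unfolding polyhedron_def by blast
  then obtain a b where ab: "\<And>h. h \<in> F \<Longrightarrow> a h \<noteq> 0 \<and> h = {x. a h \<bullet> x \<le> b h}"
    by metis
  have mem: "x \<in> h \<longleftrightarrow> a h \<bullet> x \<le> b h" if "h \<in> F" for h x
    using ab[OF that] by blast
  have "0 \<in> K"
    unfolding K_def by (simp add: hull_inc)
  have b0: "b h \<ge> 0" if "h \<in> F" for h
    using \<open>0 \<in> K\<close> F(2) mem[OF that, of 0] that by simp
  have scaled: "\<exists>c p. c \<ge> 0 \<and> p \<in> K \<and> z = c *\<^sub>R p" if "z \<in> convex_cone hull V" for z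
  proof -
    have "convex_cone hull V \<subseteq> convex_cone hull (insert 0 V)"
      by (intro hull_mono) auto
    with that have "z \<in> convex_cone hull (insert 0 V)"
      by blast
    then show ?thesis
      unfolding K_def by (subst (asm) convex_cone_hull_convex_hull_nonempty) auto
  qed
  \<comment> \<open>\<open>b h / norm (a h)\<close> is the distance from 0 to the bounding
    hyperplane of \<open>h\<close>. The extra 1 keeps \<open>R\<close> nonempty if every
    \<open>b h\<close> is 0.\<close>
  define R where "R = insert 1 ((\<lambda>h. b h / norm (a h)) ` {h\<in>F. b h > 0})"
  have R: "finite R" "\<And>q. q \<in> R \<Longrightarrow> q > 0"
    using F(1) by (auto simp: R_def ab[THEN conjunct1])
  show ?thesis
  proof
    show "Min R > 0"
      using R(1) by (intro R(2) Min_in) (auto simp: R_def)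
    show "convex_cone hull V \<inter> cball 0 (Min R) \<subseteq> convex hull (insert 0 V)"
    proof
      fix z assume z: "z \<in> convex_cone hull V \<inter> cball 0 (Min R)"
      then obtain c p where cp: "c \<ge> 0" "p \<in> K" "z = c *\<^sub>R p"
        using scaled by blast
      have "a h \<bullet> z \<le> b h" if h: "h \<in> F" for h
      proof (cases "b h = 0")
        case True
        have "p \<in> h"
          using cp(2) F(2) h by auto
        then have "a h \<bullet> p \<le> 0"
          using mem[OF h] True by simp
        then show ?thesis
          using cp True by (simp add: mult_nonneg_nonpos)
      next
        case False
        then have "Min R \<le> b h / norm (a h)"
          using R(1) h b0[OF h] by (intro Min_le) (auto simp: R_def)
        then have "norm z * norm (a h) \<le> b h"
          using z conjunct1[OF ab[OF h]] by (simp add: pos_le_divide_eq[symmetric])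
        moreover have "a h \<bullet> z \<le> norm (a h) * norm z"
          by (rule norm_cauchy_schwarz)
        ultimately show ?thesis
          by (simp add: mult.commute)
      qed
      then show "z \<in> convex hull (insert 0 V)"
        unfolding K_def[symmetric] F(2) using mem by blast
    qed
  qed
qed

text \<open>Rescaled to length \<open>r\<close>, a nonzero \<open>z\<close> lies in the polytope.
  The bound \<open>w \<bullet> z \<le> t\<close> passes from the generators (0 included, by
  \<open>t \<ge> 0\<close>) to this rescaled vector, for which the left side is
  \<open>r * norm z\<close>.\<close>

lemma norm_le_max_inner_generators:
  fixes V :: "'a::euclidean_space set"
  assumes "finite V"
  obtains r where "r > 0"
    "\<forall>z t. z \<in> convex_cone hull V \<longrightarrow> t \<ge> 0 \<longrightarrow> (\<forall>w\<in>V. w \<bullet> z \<le> t) \<longrightarrow> r * norm z \<le> t"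
proof -
  obtain r where r: "r > 0" "convex_cone hull V \<inter> cball 0 r \<subseteq> convex hull (insert 0 V)"
    using convex_cone_hull_near_0[OF assms] .
  have "r * norm z \<le> t"
    if z: "z \<in> convex_cone hull V" and t: "t \<ge> 0" "\<forall>w\<in>V. w \<bullet> z \<le> t" for z t
  proof (cases "z = 0")
    case False
    define u where "u = (r / norm z) *\<^sub>R z"
    have "u \<in> convex_cone hull V \<inter> cball 0 r"
      unfolding u_def using z r(1) False by (auto intro: convex_cone_hull_mul)
    then have "u \<in> convex hull (insert 0 V)"
      using r(2) by blast
    moreover have "convex hull (insert 0 V) \<subseteq> {w. z \<bullet> w \<le> t}"
      using t by (intro hull_minimal convex_halfspace_le) (auto simp: inner_commute)
    ultimately have "z \<bullet> u \<le> t"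
      by blast
    then show ?thesis
      using False by (simp add: u_def dot_square_norm power2_eq_square)
  qed (use t in simp)
  with r(1) show ?thesis
    using that by blast
qed

text \<open>Farkas' lemma: a hyperplane separating \<open>z\<close> from the closed cone can be
  shifted to pass through 0, because the cone is closed under scaling.\<close>

lemma convex_cone_hull_separation:
  fixes V :: "'a::euclidean_space set"
  assumes "finite V" "z \<notin> convex_cone hull V"
  obtains w where "w \<bullet> z > 0" "\<And>u. u \<in> V \<Longrightarrow> w \<bullet> u \<le> 0"
proof -
  obtain a b where ab: "a \<bullet> z < b" "\<And>x. x \<in> convex_cone hull V \<Longrightarrow> a \<bullet> x > b"
    using separating_hyperplane_closed_point[OF convex_convex_cone_hull closed_convex_cone_hull] assms
    by metis
  have "b < 0"
    using ab(2)[OF convex_cone_hull_contains_0] by simp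
  have "a \<bullet> u \<ge> 0" if "u \<in> V" for u
  proof (rule ccontr)
    assume "\<not> a \<bullet> u \<ge> 0"
    then have neg: "a \<bullet> u < 0"
      by simp
    \<comment> \<open>The positive factor makes the inner product with \<open>a\<close> exactly
      \<open>b\<close>, against the strict separation.\<close>
    have "(b / (a \<bullet> u)) *\<^sub>R u \<in> convex_cone hull V"
      using that neg \<open>b < 0\<close> by (intro convex_cone_hull_mul hull_inc) (auto simp: divide_nonpos_neg)
    from ab(2)[OF this] neg show False
      by simp
  qed
  with ab(1) \<open>b < 0\<close> show ?thesis
    by (intro that[of "- a"]) auto
qed

section \<open>Hoffman's bound by projection onto a polyhedron\<close>

text \<open>Otherwise Farkas' lemma yields a direction \<open>w\<close> at an acute angle to
  \<open>x - y\<close> that increases no active constraint. Inactive ones have slack, so a short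
  step from \<open>y\<close> along \<open>w\<close> stays in \<open>S\<close>, contradicting the
  optimality of the projection.\<close>

lemma closest_point_normal_cone:
  fixes v :: "'i \<Rightarrow> 'a::euclidean_space" and b :: "'i \<Rightarrow> real"
  assumes J: "finite J" and S: "S = {y. \<forall>j\<in>J. b j + v j \<bullet> y \<le> 0}" "S \<noteq> {}"
    and y: "y = closest_point S x"
  shows "x - y \<in> convex_cone hull (v ` {j\<in>J. b j + v j \<bullet> y = 0})"
proof (rule ccontr)
  assume notin: "\<not> ?thesis"
  have "b j + v j \<bullet> y \<le> 0 \<longleftrightarrow> v j \<bullet> y \<le> - b j" for j y
    by linarith
  then have S_Int: "S = (\<Inter>j\<in>J. {y. v j \<bullet> y \<le> - b j})"
    unfolding S by auto
  have cl: "closed S" and cv: "convex S"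
    unfolding S_Int by (auto intro!: closed_INT convex_INT closed_halfspace_le convex_halfspace_le)
  have yS: "y \<in> S"
    unfolding y using cl S(2) by (rule closest_point_in_set)
  have "finite (v ` {j\<in>J. b j + v j \<bullet> y = 0})"
    using J by simp
  then obtain w where w: "w \<bullet> (x - y) > 0"
    "\<And>u. u \<in> v ` {j\<in>J. b j + v j \<bullet> y = 0} \<Longrightarrow> w \<bullet> u \<le> 0"
    using convex_cone_hull_separation notin by metis
  have "eventually (\<lambda>e. b j + v j \<bullet> (y + e *\<^sub>R w) \<le> 0) (at_right 0)" if j: "j \<in> J" for j
  proof (cases "b j + v j \<bullet> y = 0")
    case True
    then have "v j \<bullet> w \<le> 0"
      using w(2)[of "v j"] j by (simp add: inner_commute)
    then have "b j + v j \<bullet> (y + e *\<^sub>R w) \<le> 0" if "e > 0" for e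
      using True that mult_nonneg_nonpos[of e "v j \<bullet> w"] by (simp add: inner_add_right)
    then show ?thesis
      by (auto intro: eventually_mono[OF eventually_at_right_less])
  next
    case False
    then have "b j + v j \<bullet> (y + 0 *\<^sub>R w) < 0"
      using yS j S by force
    moreover have "((\<lambda>e. b j + v j \<bullet> (y + e *\<^sub>R w)) \<longlongrightarrow> b j + v j \<bullet> (y + 0 *\<^sub>R w)) (at_right 0)"
      by (intro tendsto_intros)
    ultimately show ?thesis
      by (blast intro: order_tendstoD(2) eventually_mono less_imp_le)
  qed
  then have "eventually (\<lambda>e. \<forall>j\<in>J. b j + v j \<bullet> (y + e *\<^sub>R w) \<le> 0) (at_right 0)"
    using J by (simp add: eventually_ball_finite)
  then have "eventually (\<lambda>e. e > 0 \<and> y + e *\<^sub>R w \<in> S) (at_right 0)"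
    unfolding S by (auto intro: eventually_conj eventually_at_right_less)
  then obtain e :: real where e: "e > 0" "y + e *\<^sub>R w \<in> S"
    using eventually_happens trivial_limit_at_right_real by blast
  \<comment> \<open>This inner product is \<open>e\<close> times \<open>w \<bullet> (x - y)\<close>,
    hence also positive.\<close>
  have "(x - y) \<bullet> (y + e *\<^sub>R w - y) \<le> 0"
    unfolding y by (rule closest_point_dot) (use cl cv e y in auto)
  with e(1) w(1) show False
    by (simp add: inner_commute mult_le_0_iff)
qed

text \<open>The constant is uniform in the right-hand side \<open>b\<close>.\<close>

lemma Hoffman_bound:
  fixes v :: "'i \<Rightarrow> 'a::euclidean_space"
  assumes "finite J"
  obtains r where "r > 0"
    "\<forall>b x t. (\<exists>y. \<forall>j\<in>J. b j + v j \<bullet> y \<le> 0) \<longrightarrow> t \<ge> 0 \<longrightarrow> (\<forall>j\<in>J. b j + v j \<bullet> x \<le> t) \<longrightarrow>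
       (\<exists>y. (\<forall>j\<in>J. b j + v j \<bullet> y \<le> 0) \<and> r * norm (x - y) \<le> t)"
proof -
  \<comment> \<open>The active set depends on \<open>b\<close> and \<open>x\<close>, but it is one
    of the finitely many subsets of \<open>J\<close>; the minimum of their constants serves
    all.\<close>
  have "\<exists>r>0. \<forall>z t. z \<in> convex_cone hull (v ` A) \<longrightarrow> t \<ge> 0 \<longrightarrow> (\<forall>w\<in>v ` A. w \<bullet> z \<le> t) \<longrightarrow> r * norm z \<le> t"
    if "A \<in> Pow J" for A
  proof -
    have "finite (v ` A)"
      using that assms by (auto intro: finite_subset)
    then show ?thesis
      by (rule norm_le_max_inner_generators) (intro exI conjI)
  qed
  then obtain \<rho> where \<rho>: "\<And>A. A \<in> Pow J \<Longrightarrow> \<rho> A > 0"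
    "\<And>A z t. A \<in> Pow J \<Longrightarrow> z \<in> convex_cone hull (v ` A) \<Longrightarrow> t \<ge> 0 \<Longrightarrow> (\<forall>w\<in>v ` A. w \<bullet> z \<le> t) \<Longrightarrow>
       \<rho> A * norm z \<le> t"
    by metis
  define r where "r = Min (\<rho> ` Pow J)"
  have fin: "finite (\<rho> ` Pow J)"
    using assms by simp
  show ?thesis
  proof
    show "r > 0"
      unfolding r_def using fin \<rho>(1) by (subst Min_gr_iff) auto
  next
    show "\<forall>b x t. (\<exists>y. \<forall>j\<in>J. b j + v j \<bullet> y \<le> 0) \<longrightarrow> t \<ge> 0 \<longrightarrow> (\<forall>j\<in>J. b j + v j \<bullet> x \<le> t) \<longrightarrow>
       (\<exists>y. (\<forall>j\<in>J. b j + v j \<bullet> y \<le> 0) \<and> r * norm (x - y) \<le> t)"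
    proof (intro allI impI)
      fix b x and t :: real
      assume ne: "\<exists>y. \<forall>j\<in>J. b j + v j \<bullet> y \<le> 0" and "t \<ge> 0"
        and t: "\<forall>j\<in>J. b j + v j \<bullet> x \<le> t"
      define S where "S = {y. \<forall>j\<in>J. b j + v j \<bullet> y \<le> 0}"
      define y where "y = closest_point S x"
      define A where "A = {j\<in>J. b j + v j \<bullet> y = 0}"
      have A: "A \<in> Pow J"
        by (auto simp: A_def)
      have "closed {y. b j + v j \<bullet> y \<le> 0}" for j
        by (intro closed_Collect_le continuous_intros)
      then have "closed S"
        unfolding S_def by (simp add: Collect_ball_eq closed_INT)
      then have "y \<in> S"
        unfolding y_def using ne S_def by (intro closest_point_in_set) auto
      have "x - y \<in> convex_cone hull (v ` A)"
        unfolding A_def using assms S_def ne y_def by (intro closest_point_normal_cone) auto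
      \<comment> \<open>For active \<open>j\<close>, \<open>v j \<bullet> (x - y)\<close> is the
        residual \<open>b j + v j \<bullet> x\<close>.\<close>
      moreover have "\<forall>w\<in>v ` A. w \<bullet> (x - y) \<le> t"
      proof clarify
        fix j assume "j \<in> A"
        then have "j \<in> J" "b j + v j \<bullet> y = 0"
          by (auto simp: A_def)
        then show "v j \<bullet> (x - y) \<le> t"
          using t by (force simp: inner_diff_right)
      qed
      ultimately have "\<rho> A * norm (x - y) \<le> t"
        using \<rho>(2) A \<open>t \<ge> 0\<close> by blast
      moreover have "r \<le> \<rho> A"
        unfolding r_def using fin A by (intro Min_le) auto
      ultimately have "r * norm (x - y) \<le> t"
        by (meson mult_right_mono norm_ge_zero order_trans)
      with \<open>y \<in> S\<close> show "\<exists>y. (\<forall>j\<in>J. b j + v j \<bullet> y \<le> 0) \<and> r * norm (x - y) \<le> t"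
        by (auto simp: S_def)
    qed
  qed
qed

text \<open>As Hoffman's constant is the same for all right-hand sides, the relaxed systems have
  solutions in one common ball, and a cluster point solves the limit system.\<close>

lemma linear_system_solvable_if_approximately:
  fixes v :: "'i \<Rightarrow> 'a::euclidean_space" and b :: "'i \<Rightarrow> real"
  assumes "finite J" and approx: "\<And>e. e > 0 \<Longrightarrow> \<exists>y. \<forall>j\<in>J. b j + v j \<bullet> y \<le> e"
  obtains y where "\<forall>j\<in>J. b j + v j \<bullet> y \<le> 0"
proof -
  obtain r where r: "r > 0"
    "\<forall>b x t. (\<exists>y. \<forall>j\<in>J. b j + v j \<bullet> y \<le> 0) \<longrightarrow> t \<ge> 0 \<longrightarrow> (\<forall>j\<in>J. b j + v j \<bullet> x \<le> t) \<longrightarrow>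
       (\<exists>y. (\<forall>j\<in>J. b j + v j \<bullet> y \<le> 0) \<and> r * norm (x - y) \<le> t)"
    using Hoffman_bound[OF assms(1), of v] .
  \<comment> \<open>A bound for the residuals at the origin, which places the solutions
    \<open>y n\<close> in the ball of radius \<open>t / r\<close>.\<close>
  define t where "t = (\<Sum>j\<in>J. \<bar>b j\<bar>)"
  have t: "t \<ge> 0" "\<And>j. j \<in> J \<Longrightarrow> b j \<le> t"
    unfolding t_def using member_le_sum[of _ J "\<lambda>j. \<bar>b j\<bar>"] assms(1)
    by (auto intro: sum_nonneg order_trans[OF abs_ge_self])
  define e where "e n = inverse (real (Suc n))" for n
  have "\<exists>y. (\<forall>j\<in>J. b j + v j \<bullet> y \<le> e n) \<and> r * norm y \<le> t" for n
  proof -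
    have "e n > 0"
      by (simp add: e_def)
    have "\<exists>y. (\<forall>j\<in>J. (b j - e n) + v j \<bullet> y \<le> 0) \<and> r * norm (0 - y) \<le> t"
    proof (rule r(2)[rule_format])
      show "\<exists>y. \<forall>j\<in>J. (b j - e n) + v j \<bullet> y \<le> 0"
        using approx[OF \<open>e n > 0\<close>] by (auto simp: algebra_simps)
      show "(b j - e n) + v j \<bullet> 0 \<le> t" if "j \<in> J" for j
        using t(2)[OF that] \<open>e n > 0\<close> by simp
    qed (rule t)
    then show ?thesis
      by (auto simp: algebra_simps)
  qed
  then obtain y where y: "\<And>n j. j \<in> J \<Longrightarrow> b j + v j \<bullet> y n \<le> e n" "\<And>n. r * norm (y n) \<le> t"
    by metis
  have "\<forall>n. y n \<in> cball 0 (t / r)"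
    using y(2) r(1) by (simp add: field_simps)
  then obtain z \<sigma> where z: "strict_mono \<sigma>" "(y \<circ> \<sigma>) \<longlonglongrightarrow> z"
    using compact_cball[of "0::'a" "t / r"] unfolding compact_def by meson
  have "e \<longlonglongrightarrow> 0"
    unfolding e_def by (rule LIMSEQ_inverse_real_of_nat)
  then have e: "(e \<circ> \<sigma>) \<longlonglongrightarrow> 0"
    using z(1) by (rule LIMSEQ_subseq_LIMSEQ)
  have "b j + v j \<bullet> z \<le> 0" if "j \<in> J" for j
  proof (rule LIMSEQ_le)
    show "(\<lambda>n. b j + v j \<bullet> (y \<circ> \<sigma>) n) \<longlonglongrightarrow> b j + v j \<bullet> z"
      by (intro tendsto_intros z(2))
    show "(e \<circ> \<sigma>) \<longlonglongrightarrow> 0"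
      by (rule e)
  qed (use y(1)[OF that] in auto)
  then show ?thesis
    using that by blast
qed

section \<open>Arbitrary norms and a single max-affine function\<close>

text \<open>Half of the equivalence of norms, by expansion in the orthonormal basis; it carries
  Euclidean distance estimates over to \<open>N\<close>.\<close>

lemma is_norm_le_norm:
  fixes N :: "'a::euclidean_space \<Rightarrow> real"
  assumes "is_norm N"
  obtains B where "B > 0" "\<And>x. N x \<le> B * norm x"
proof -
  have N: "\<And>x. N x \<ge> 0" "N 0 = 0" "\<And>c x. N (c *\<^sub>R x) = \<bar>c\<bar> * N x" "\<And>x y. N (x + y) \<le> N x + N y"
    using assms unfolding is_norm_def by auto
  have sum_le: "N (sum g A) \<le> (\<Sum>i\<in>A. N (g i))" if "finite A" for g :: "'a \<Rightarrow> 'a" and A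
    using that
  proof (induction A rule: finite_induct)
    case (insert i A)
    then show ?case
      using N(4)[of "g i" "sum g A"] by simp
  qed (simp add: N(2))
  define B where "B = (\<Sum>u\<in>Basis. N (u::'a))"
  have "N x \<le> B * norm x" for x
  proof -
    have "N x = N (\<Sum>u\<in>Basis. (x \<bullet> u) *\<^sub>R u)"
      by (simp add: euclidean_representation)
    also have "\<dots> \<le> (\<Sum>u\<in>Basis. N ((x \<bullet> u) *\<^sub>R u))"
      by (rule sum_le) simp
    also have "\<dots> \<le> (\<Sum>u\<in>Basis. norm x * N u)"
      using N(1) Basis_le_norm by (intro sum_mono) (auto simp: N(3) intro!: mult_right_mono)
    finally show ?thesis
      by (simp add: B_def sum_distrib_left mult.commute)
  qed
  then have "N x \<le> (B + 1) * norm x" for x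
    by (rule order_trans) (simp add: mult_right_mono)
  moreover have "B + 1 > 0"
    using sum_nonneg[of Basis N] N(1) by (simp add: B_def add_nonneg_pos)
  ultimately show ?thesis
    using that by blast
qed

lemma norm_dist_le:
  assumes "is_norm N" "y \<in> Q"
  shows "norm_dist N x Q \<le> N (x - y)"
  unfolding norm_dist_def using assms
  by (intro cINF_lower bdd_belowI[of _ 0]) (auto simp: is_norm_def)

text \<open>The condition \<open>g x \<le> t\<close> is a linear system, so Hoffman's bound applies
  with residual \<open>g x\<close>. A witness \<open>y\<close> is returned instead of a distance so
  that it can later serve as a point of the larger sublevel set of \<open>f\<close>.\<close>

lemma max_affine_error_bound:
  fixes N :: "'a::euclidean_space \<Rightarrow> real" and v :: "'i \<Rightarrow> 'a"
  assumes N: "is_norm N" and J: "finite J" "J \<noteq> {}"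
    and g: "\<And>x. g x = (MAX j\<in>J. b j + v j \<bullet> x)"
    and inf: "inf_value g \<le> 0"
  obtains \<tau> where "\<tau> > 0" "\<And>x. g x \<ge> 0 \<Longrightarrow> \<exists>y. g y \<le> 0 \<and> \<tau> * N (x - y) \<le> g x"
proof -
  have le_iff: "g x \<le> t \<longleftrightarrow> (\<forall>j\<in>J. b j + v j \<bullet> x \<le> t)" for x t
    using J by (simp add: g)
  have "\<exists>y. \<forall>j\<in>J. b j + v j \<bullet> y \<le> e" if "e > 0" for e
  proof -
    have "(INF x. ereal (g x)) < ereal e"
      using inf that unfolding inf_value_def by (simp add: order_le_less_trans)
    then obtain y where "g y < e"
      by (auto simp: INF_less_iff)
    then show ?thesis
      using le_iff[of y e] by auto
  qed
  then obtain y0 where y0: "\<forall>j\<in>J. b j + v j \<bullet> y0 \<le> 0"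
    using linear_system_solvable_if_approximately[OF J(1)] by metis
  obtain r where r: "r > 0"
    "\<forall>b x t. (\<exists>y. \<forall>j\<in>J. b j + v j \<bullet> y \<le> 0) \<longrightarrow> t \<ge> 0 \<longrightarrow> (\<forall>j\<in>J. b j + v j \<bullet> x \<le> t) \<longrightarrow>
       (\<exists>y. (\<forall>j\<in>J. b j + v j \<bullet> y \<le> 0) \<and> r * norm (x - y) \<le> t)"
    using Hoffman_bound[OF J(1), of v] .
  obtain B where B: "B > 0" "\<And>x. N x \<le> B * norm x"
    using is_norm_le_norm[OF N] by metis
  show ?thesis
  proof
    show "r / B > 0"
      using r(1) B(1) by simp
    fix x assume "g x \<ge> 0"
    then obtain y where y: "\<forall>j\<in>J. b j + v j \<bullet> y \<le> 0" "r * norm (x - y) \<le> g x"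
      using r(2) y0 le_iff[of x "g x"] by blast
    have "r / B * N (x - y) \<le> r / B * (B * norm (x - y))"
      using r(1) B by (intro mult_left_mono) auto
    also have "\<dots> = r * norm (x - y)"
      using B(1) by simp
    finally show "\<exists>y. g y \<le> 0 \<and> r / B * N (x - y) \<le> g x"
      using y le_iff by fastforce
  qed
qed

section \<open>Minima of max-affine functions\<close>

theorem theorem4:
  fixes N :: "'a::euclidean_space \<Rightarrow> real"
    and f :: "'a \<Rightarrow> real"
    and fi :: "nat \<Rightarrow> 'a \<Rightarrow> real"
    and l :: nat
    and s :: "nat \<Rightarrow> nat"
    and a :: "nat \<Rightarrow> nat \<Rightarrow> real"
    and v :: "nat \<Rightarrow> nat \<Rightarrow> 'a"
  assumes "is_norm N"
    and "piecewise_affine f"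
    and "l \<ge> 1"
    and "\<And>i. i \<in> {1..l} \<Longrightarrow> s i \<ge> 1"
    and "\<And>i x. i \<in> {1..l} \<Longrightarrow> fi i x = (MAX j\<in>{1..s i}. a i j + v i j \<bullet> x)"
    and "\<And>x. f x = (MIN i\<in>{1..l}. fi i x)"
    and "sublevel f \<noteq> {}"
  shows "((\<forall>i\<in>{1..l}. inf_value (fi i) \<le> 0) \<longrightarrow> global_error_bound N f) \<and>
         ((\<exists>i\<in>{1..l}. inf_value (fi i) > 0) \<longrightarrow>
            error_bound_on N f
              {x. ereal (f x) < Min {inf_value (fi i) |i. i \<in> {1..l} \<and> inf_value (fi i) > 0}})"
proof -
  define P where "P = {i\<in>{1..l}. inf_value (fi i) \<le> 0}"
  have "finite P"
    by (simp add: P_def)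
  have f_le: "f x \<le> fi i x" if "i \<in> {1..l}" for i x
    using that by (simp add: assms(6))
  have "\<exists>t>0. \<forall>x. fi i x \<ge> 0 \<longrightarrow> (\<exists>y. fi i y \<le> 0 \<and> t * N (x - y) \<le> fi i x)" if "i \<in> P" for i
  proof -
    have i: "i \<in> {1..l}" "inf_value (fi i) \<le> 0"
      using that by (auto simp: P_def)
    show ?thesis
      by (rule max_affine_error_bound[OF assms(1) _ _ assms(5)[OF i(1)] i(2)])
        (use assms(4)[OF i(1)] in auto)
  qed
  then obtain \<tau> where \<tau>: "\<And>i. i \<in> P \<Longrightarrow> \<tau> i > 0"
    "\<And>i x. i \<in> P \<Longrightarrow> fi i x \<ge> 0 \<Longrightarrow> \<exists>y. fi i y \<le> 0 \<and> \<tau> i * N (x - y) \<le> fi i x"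
    by metis
  \<comment> \<open>The 1 makes the minimum well defined without first showing \<open>P\<close>
    nonempty.\<close>
  define T where "T = Min (insert 1 (\<tau> ` P))"
  have "T > 0"
    unfolding T_def using \<open>finite P\<close> \<tau>(1) by (subst Min_gr_iff) auto
  have N0: "N z \<ge> 0" "N 0 = 0" for z
    using assms(1) by (auto simp: is_norm_def)
  \<comment> \<open>Both statements reduce to this: at points of \<open>V\<close> only pieces in
    \<open>P\<close> attain the minimum.\<close>
  have error_bound: "error_bound_on N f V"
    if V: "\<And>x i. x \<in> V \<Longrightarrow> i \<in> {1..l} \<Longrightarrow> f x = fi i x \<Longrightarrow> i \<in> P" for V
    unfolding error_bound_on_def
  proof (intro exI[of _ T] conjI ballI)
    fix x assume "x \<in> V"
    show "T * norm_dist N x (sublevel f) \<le> pos_part f x"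
    proof (cases "f x \<le> 0")
      case True
      then have "norm_dist N x (sublevel f) \<le> 0"
        using norm_dist_le[OF assms(1), of x "sublevel f" x] N0(2) by (simp add: sublevel_def)
      with True \<open>T > 0\<close> show ?thesis
        by (simp add: pos_part_def mult_nonneg_nonpos)
    next
      case False
      have "f x \<in> (\<lambda>i. fi i x) ` {1..l}"
        unfolding assms(6) using assms(3) by (intro Min_in) auto
      then obtain i where i: "i \<in> {1..l}" "f x = fi i x"
        by blast
      then have "i \<in> P"
        using V \<open>x \<in> V\<close> by blast
      then obtain y where y: "fi i y \<le> 0" "\<tau> i * N (x - y) \<le> fi i x"
        using \<tau>(2)[of i x] False i(2) by auto
      have "y \<in> sublevel f"
        using f_le[OF i(1), of y] y(1) by (simp add: sublevel_def)
      then have "T * norm_dist N x (sublevel f) \<le> T * N (x - y)"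
        using \<open>T > 0\<close> norm_dist_le[OF assms(1)] by (intro mult_left_mono) auto
      also have "\<dots> \<le> \<tau> i * N (x - y)"
        unfolding T_def using \<open>finite P\<close> \<open>i \<in> P\<close> N0(1) by (intro mult_right_mono Min_le) auto
      finally show ?thesis
        using y(2) i(2) by (simp add: pos_part_def)
    qed
  qed (rule \<open>T > 0\<close>)
  show ?thesis
  proof (intro conjI impI)
    assume "\<forall>i\<in>{1..l}. inf_value (fi i) \<le> 0"
    then show "global_error_bound N f"
      unfolding global_error_bound_def by (intro error_bound) (auto simp: P_def)
  next
    let ?M = "{inf_value (fi i) |i. i \<in> {1..l} \<and> inf_value (fi i) > 0}"
    \<comment> \<open>A piece outside \<open>P\<close> has its infimum in \<open>?M\<close>, so
      \<open>f x = fi i x\<close> would be at least \<open>Min ?M\<close>.\<close>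
    show "error_bound_on N f {x. ereal (f x) < Min ?M}"
    proof (rule error_bound, rule ccontr)
      fix x i
      assume x: "x \<in> {x. ereal (f x) < Min ?M}" and i: "i \<in> {1..l}" "f x = fi i x" "i \<notin> P"
      have "Min ?M \<le> inf_value (fi i)"
        using i by (intro Min_le) (auto simp: P_def)
      also have "\<dots> \<le> ereal (fi i x)"
        unfolding inf_value_def by (rule INF_lower) simp
      finally show False
        using x i(2) by simp
    qed
  qed
qed

end
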